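(* Let $p$ be a prime and let $A=(a_1,\dots,a_p)$ be a sequence of $p$ nonzero elements of $\mathbb{F}_p$. Then one of the following holds. (i) $\dim(A)=1$ and there exists $r\in\mathbb{F}_p^*$ such that $(a_1,\dots,a_p)=(r,\dots,r)$. (ii) $\dim(A)=p-2$ and there exist $t\in[1,p-3]$, a permutation $\sigma$ of $[1,p]$ and $r\in\mathbb{F}_p^*$ such that $(a_{\sigma(1)},\dots,a_{\sigma(p)})$ consists of $t$ copies of $r$, followed by $p-2-t$ copies of $-r$, followed by $-(t+1)r,-(t+1)r$. (iii) $\dim(A)=p-1$.
   Context: For a sequence $A=(a_1,\dots,a_\ell)$ of nonzero elements of $\mathbb{F}_p$, $\mathcal{S}_A=\{x\in\{0,1\}^\ell : \sum_i a_ix_i=0 \text{ in } \mathbb{F}_p\}$ and $\dim(A)$ is the dimension of the $\mathbb{F}_p$-linear span of $\mathcal{S}_A$ in $\mathbb{F}_p^\ell$. *)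

theory Defs
  imports
    "Berlekamp_Zassenhaus.Finite_Field"
    "Jordan_Normal_Form.VS_Connect"
    "HOL-Combinatorics.Permutations"
begin

text \<open>
  The field with \<open>p\<close> elements is \<open>'p mod_ring\<close> with \<open>'p :: prime_card\<close> and \<open>p = CARD('p)\<close>.
  A sequence \<open>(a\<^sub>1, \<dots>, a\<^sub>l)\<close> is a list \<open>A\<close> of length \<open>l\<close>, so \<open>a\<^sub>i\<close> is \<open>A ! (i - 1)\<close>.
\<close>

definition zero_sum_vecs :: "'p :: prime_card mod_ring list \<Rightarrow> 'p mod_ring vec set" where
  "zero_sum_vecs A =
     {x \<in> carrier_vec (length A).
        (\<forall>i < length A. x $ i \<in> {0, 1}) \<and> (\<Sum>i < length A. A ! i * x $ i) = 0}"

text \<open>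
  \<open>module_vec TYPE('p mod_ring) l\<close> is the vector space of column vectors of length \<open>l\<close>;
  replacing its carrier turns the span of \<open>zero_sum_vecs A\<close> into a vector space of its own.
\<close>

definition seq_dim :: "'p :: prime_card mod_ring list \<Rightarrow> nat" where
  "seq_dim A =
     (let V = module_vec TYPE('p mod_ring) (length A)
      in vectorspace.dim class_ring
           (V\<lparr>carrier := LinearCombinations.module.span class_ring V (zero_sum_vecs A)\<rparr>))"

end

theory Submission
  imports
    Defs
    "Jordan_Normal_Form.Matrix_Kernel"
    "Jordan_Normal_Form.DL_Rank"
begin

text \<open>
  Let \<open>b\<close> be orthogonal to all zero-sum \<open>0\<close>-\<open>1\<close> vectors and write \<open>b\<^sub>k = a\<^sub>k c\<^sub>k\<close>. By Fermat,
  \<open>a(I)\<^bsup>p-1\<^esup> b(I) = b(I)\<close> for every index set \<open>I\<close>, where \<open>a(I)\<close> and \<open>b(I)\<close> denote subset sums, so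
  the alternating sum of \<open>a(I)\<^bsup>p-1\<^esup> b(I)\<close> over the subsets of any \<open>M\<close> with at least two elements
  vanishes. For \<open>M\<close> of size \<open>p\<close>, \<open>p - 1\<close> and \<open>p - 2\<close> these sums are explicit. With \<open>s = \<Sum> a\<^sub>k\<close>,
  \<open>Q = \<Sum> a\<^sub>k\<^sup>2\<close> and \<open>W = \<Sum> a\<^sub>k\<^sup>2 c\<^sub>k\<close> they give \<open>\<Sum> c\<^sub>k = 0\<close>, then \<open>\<Sum> b\<^sub>k = s c\<^sub>j\<close> for all \<open>j\<close>, and, if
  \<open>s = 0\<close>, \<open>2 (c\<^sub>i - c\<^sub>j) (a\<^sub>i\<^sup>2 - a\<^sub>j\<^sup>2) = Q (c\<^sub>i + c\<^sub>j) - 2 W\<close> for all \<open>i \<noteq> j\<close>. If \<open>s \<noteq> 0\<close>, then \<open>c\<close> is constant,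
  so \<open>b\<close> is a multiple of \<open>a\<close>. If \<open>s = 0\<close>, then \<open>c\<close> is constant, or all \<open>a\<^sub>k\<close> are equal, or \<open>c\<close> is constant
  outside a pair \<open>i, j\<close> with \<open>a\<^sub>i = a\<^sub>j\<close> while the other \<open>a\<^sub>k\<close> agree up to sign. The dimension is then
  read off from the orthogonal complement.
\<close>

section \<open>Alternating sums over subsets\<close>

text \<open>The top mixed difference of \<open>f\<close> on the subset lattice of \<open>N\<close>;
  the sign counts the complement, so \<open>N\<close> itself has coefficient 1.\<close>

definition alt_sum :: "'i set \<Rightarrow> ('i set \<Rightarrow> 'a::comm_ring_1) \<Rightarrow> 'a" where
  "alt_sum N f = (\<Sum>I\<in>Pow N. (- 1) ^ card (N - I) * f I)"

lemma alt_sum_empty [simp]: "alt_sum {} f = f {}"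
  by (simp add: alt_sum_def)

lemma alt_sum_cong: "(\<And>I. I \<subseteq> N \<Longrightarrow> f I = g I) \<Longrightarrow> alt_sum N f = alt_sum N g"
  unfolding alt_sum_def by (rule sum.cong) auto

lemma sum_Pow_containing:
  assumes "k \<in> N"
  shows "(\<Sum>I | I \<subseteq> N \<and> k \<in> I. f I) = (\<Sum>J\<in>Pow (N - {k}). f (insert k J))"
  by (rule sum.reindex_bij_witness[of _ "insert k" "\<lambda>I. I - {k}"]) (use assms in \<open>auto simp: insert_absorb\<close>)

text \<open>Expand \<open>sum a I\<close> and exchange the sums. The sets containing
  \<open>k\<close> are \<open>insert k J\<close> with \<open>J\<close> inside
  \<open>N - {k}\<close>; the complement of \<open>insert k J\<close> in \<open>N\<close> is that of
  \<open>J\<close> in \<open>N - {k}\<close>, so the signs survive.\<close>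

lemma alt_sum_mult_linear:
  fixes a :: "'i \<Rightarrow> 'a::comm_ring_1"
  assumes "finite N"
  shows "alt_sum N (\<lambda>I. sum a I * g I) = (\<Sum>k\<in>N. a k * alt_sum (N - {k}) (\<lambda>J. g (insert k J)))"
proof -
  have "alt_sum N (\<lambda>I. sum a I * g I)
      = (\<Sum>I\<in>Pow N. \<Sum>k\<in>I. (- 1) ^ card (N - I) * (a k * g I))"
    unfolding alt_sum_def by (simp add: sum_distrib_left sum_distrib_right)
  also have "\<dots> = (\<Sum>I\<in>Pow N. \<Sum>k\<in>{k \<in> N. k \<in> I}. (- 1) ^ card (N - I) * (a k * g I))"
    by (intro sum.cong) auto
  also have "\<dots> = (\<Sum>k\<in>N. \<Sum>I\<in>{I \<in> Pow N. k \<in> I}. (- 1) ^ card (N - I) * (a k * g I))"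
    by (rule sum.swap_restrict) (use assms in auto)
  also have "\<dots> = (\<Sum>k\<in>N. a k * alt_sum (N - {k}) (\<lambda>J. g (insert k J)))"
  proof (rule sum.cong[OF refl])
    fix k assume k: "k \<in> N"
    have "(\<Sum>I\<in>{I \<in> Pow N. k \<in> I}. (- 1) ^ card (N - I) * (a k * g I))
        = (\<Sum>J\<in>Pow (N - {k}). (- 1) ^ card (N - insert k J) * (a k * g (insert k J)))"
      using sum_Pow_containing[OF k] by simp
    also have "\<dots> = a k * alt_sum (N - {k}) (\<lambda>J. g (insert k J))"
      unfolding alt_sum_def sum_distrib_left
    proof (rule sum.cong[OF refl])
      fix J assume "J \<in> Pow (N - {k})"
      have "N - insert k J = N - {k} - J" by auto
      then show "(- 1) ^ card (N - insert k J) * (a k * g (insert k J))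
          = a k * ((- 1) ^ card (N - {k} - J) * g (insert k J))"
        by (simp add: mult_ac)
    qed
    finally show "(\<Sum>I\<in>{I \<in> Pow N. k \<in> I}. (- 1) ^ card (N - I) * (a k * g I))
        = a k * alt_sum (N - {k}) (\<lambda>J. g (insert k J))" .
  qed
  finally show ?thesis .
qed

text \<open>For a fixed \<open>k\<close> in \<open>N\<close>, the sets with and without
  \<open>k\<close> pair off with opposite signs.\<close>

lemma alt_sum_const:
  assumes "finite N" "N \<noteq> {}"
  shows "alt_sum N (\<lambda>I. c) = 0"
proof -
  from assms(2) obtain k where k: "k \<in> N" by auto
  have "(\<Sum>I\<in>Pow N. (- 1) ^ card (N - I) * c)
      = (\<Sum>I | I \<subseteq> N \<and> k \<in> I. (- 1) ^ card (N - I) * c) + (\<Sum>I | I \<subseteq> N \<and> k \<notin> I. (- 1) ^ card (N - I) * c)"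
    by (subst sum.union_disjoint[symmetric]) (use assms in \<open>auto intro!: sum.cong\<close>)
  also have "(\<Sum>I | I \<subseteq> N \<and> k \<notin> I. (- 1) ^ card (N - I) * c) = (\<Sum>J\<in>Pow (N - {k}). (- 1) ^ card (N - J) * c)"
    by (rule sum.cong) auto
  also have "\<dots> = (\<Sum>J\<in>Pow (N - {k}). - ((- 1) ^ card (N - insert k J) * c))"
  proof (rule sum.cong[OF refl])
    fix J assume "J \<in> Pow (N - {k})"
    then have "N - J = insert k (N - insert k J)" using k by auto
    then have "card (N - J) = Suc (card (N - insert k J))"
      using assms(1) by (metis Diff_iff card_insert_disjoint finite_Diff insertI1)
    then show "(- 1) ^ card (N - J) * c = - ((- 1) ^ card (N - insert k J) * c)" by simp
  qed
  also have "(\<Sum>I | I \<subseteq> N \<and> k \<in> I. (- 1) ^ card (N - I) * c) = (\<Sum>J\<in>Pow (N - {k}). (- 1) ^ card (N - insert k J) * c)"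
    by (rule sum_Pow_containing[OF k])
  finally show ?thesis by (simp add: alt_sum_def sum_negf)
qed

text \<open>Formally the coefficient of \<open>T^m / m!\<close> in \<open>exp(y T)\<close> times the
  product of the \<open>exp(a k T) - 1\<close>. The offset \<open>y\<close> is there because
  deleting an index \<open>k\<close> from \<open>N\<close> moves \<open>a k\<close> into it.\<close>

definition alt_power_sum :: "('i \<Rightarrow> 'a::comm_ring_1) \<Rightarrow> 'i set \<Rightarrow> nat \<Rightarrow> 'a \<Rightarrow> 'a" where
  "alt_power_sum a N m y = alt_sum N (\<lambda>I. (y + sum a I) ^ m)"

lemma alt_power_sum_empty [simp]: "alt_power_sum a {} m y = y ^ m"
  by (simp add: alt_power_sum_def)

lemma alt_sum_weighted:
  assumes "finite N"
  shows "alt_sum N (\<lambda>I. sum b I * (y + sum a I) ^ m)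
    = (\<Sum>k\<in>N. b k * alt_power_sum a (N - {k}) m (y + a k))"
proof -
  have "alt_sum (N - {k}) (\<lambda>J. (y + sum a (insert k J)) ^ m) = alt_power_sum a (N - {k}) m (y + a k)" for k
    unfolding alt_power_sum_def
  proof (rule alt_sum_cong)
    fix J assume "J \<subseteq> N - {k}"
    then have "finite J" "k \<notin> J" using assms finite_subset by auto
    then show "(y + sum a (insert k J)) ^ m = (y + a k + sum a J) ^ m" by (simp add: add_ac)
  qed
  then show ?thesis by (simp add: alt_sum_mult_linear[OF assms])
qed

text \<open>One factor \<open>y + sum a I\<close> is split off the power. This lowers the exponent,
  partly at the price of one index, and drives the inductions below.\<close>

lemma alt_power_sum_Suc:
  assumes "finite N"
  shows "alt_power_sum a N (Suc m) y
    = y * alt_power_sum a N m y + (\<Sum>k\<in>N. a k * alt_power_sum a (N - {k}) m (y + a k))"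
proof -
  have "alt_power_sum a N (Suc m) y
      = y * alt_power_sum a N m y + alt_sum N (\<lambda>I. sum a I * (y + sum a I) ^ m)"
    unfolding alt_power_sum_def alt_sum_def power_Suc sum_distrib_left sum.distrib[symmetric]
    by (intro sum.cong refl) (simp only: distrib_left distrib_right mult.left_commute)
  then show ?thesis by (simp add: alt_sum_weighted[OF assms])
qed

text \<open>
  The next four lemmas are the lowest coefficients of
  \<open>exp(y T) \<Prod>(exp(a\<^sub>k T) - 1) = \<Prod>(a\<^sub>kT) exp((y + S/2) T + Q T\<^sup>2/24 + \<dots>)\<close> with \<open>S = \<Sum> a\<^sub>k\<close> and \<open>Q = \<Sum> a\<^sub>k\<^sup>2\<close>,
  multiplied by \<open>2\<close> and \<open>24\<close> to clear denominators.
\<close>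

lemma alt_power_sum_eq_0:
  "finite N \<Longrightarrow> m < card N \<Longrightarrow> alt_power_sum a N m y = 0"
proof (induction m arbitrary: N y)
  case 0
  then have "alt_sum N (\<lambda>I. (1 :: 'b)) = 0" by (intro alt_sum_const) auto
  then show ?case by (simp add: alt_power_sum_def)
next
  case (Suc m)
  then show ?case by (simp add: alt_power_sum_Suc)
qed

lemma alt_power_sum_card:
  "finite N \<Longrightarrow> card N = n \<Longrightarrow> alt_power_sum a N n y = of_nat (fact n) * prod a N"
proof (induction n arbitrary: N y)
  case (Suc n)
  have "a k * alt_power_sum a (N - {k}) n (y + a k) = of_nat (fact n) * prod a N" if k: "k \<in> N" for k
  proof -
    have "alt_power_sum a (N - {k}) n (y + a k) = of_nat (fact n) * prod a (N - {k})"
      using Suc k by simp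
    then show ?thesis
      by (simp add: prod.remove[OF Suc.prems(1) k] mult.left_commute)
  qed
  then have "(\<Sum>k\<in>N. a k * alt_power_sum a (N - {k}) n (y + a k)) = of_nat (Suc n) * (of_nat (fact n) * prod a N)"
    using Suc.prems by simp
  then show ?case
    using Suc.prems by (simp only: alt_power_sum_Suc alt_power_sum_eq_0 fact_Suc of_nat_mult of_nat_id) (simp add: mult.assoc)
qed auto

lemma alt_power_sum_Suc_card:
  "finite N \<Longrightarrow> card N = n \<Longrightarrow>
    2 * alt_power_sum a N (Suc n) y = of_nat (fact (Suc n)) * prod a N * (2 * y + sum a N)"
proof (induction n arbitrary: N y)
  case (Suc n)
  define S F where "S = sum a N" and "F = of_nat (fact (Suc n)) * prod a N"
  have *: "2 * (a k * alt_power_sum a (N - {k}) (Suc n) (y + a k)) = F * (2 * y + S + a k)"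
    if k: "k \<in> N" for k
  proof -
    have "2 * (a k * alt_power_sum a (N - {k}) (Suc n) (y + a k))
        = a k * (2 * alt_power_sum a (N - {k}) (Suc n) (y + a k))"
      by (rule mult.left_commute)
    also have "\<dots> = a k * (of_nat (fact (Suc n)) * prod a (N - {k}) * (2 * (y + a k) + sum a (N - {k})))"
      using Suc.IH[of "N - {k}"] Suc.prems k by (simp only: finite_Diff card_Diff_singleton diff_Suc_1)
    also have "\<dots> = of_nat (fact (Suc n)) * (a k * prod a (N - {k})) * (2 * (y + a k) + sum a (N - {k}))"
      by (simp only: mult_ac)
    also have "a k * prod a (N - {k}) = prod a N"
      using Suc.prems(1) k by (simp add: prod.remove)
    also have "sum a (N - {k}) = S - a k"
      unfolding S_def using Suc.prems(1) k by (simp add: sum_diff1)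
    also have "2 * (y + a k) + (S - a k) = 2 * y + S + a k"
      by (simp add: algebra_simps)
    finally show ?thesis unfolding F_def .
  qed
  have "2 * (\<Sum>k\<in>N. a k * alt_power_sum a (N - {k}) (Suc n) (y + a k))
      = F * (\<Sum>k\<in>N. 2 * y + S + a k)"
    unfolding sum_distrib_left using * by (intro sum.cong) auto
  also have "(\<Sum>k\<in>N. 2 * y + S + a k) = of_nat (Suc n) * (2 * y + S) + S"
    using Suc.prems by (simp add: sum.distrib S_def)
  finally have sum: "2 * (\<Sum>k\<in>N. a k * alt_power_sum a (N - {k}) (Suc n) (y + a k))
      = F * (of_nat (Suc n) * (2 * y + S) + S)" .
  \<comment> \<open>\<open>N\<close> has \<open>Suc n\<close> elements, so the first term of the
    recursion is a leading coefficient.\<close>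
  have low: "alt_power_sum a N (Suc n) y = F"
    unfolding F_def by (rule alt_power_sum_card) (use Suc.prems in auto)
  have "2 * alt_power_sum a N (Suc (Suc n)) y
      = 2 * (y * F) + F * (of_nat (Suc n) * (2 * y + S) + S)"
    unfolding alt_power_sum_Suc[OF Suc.prems(1), of _ "Suc n"] distrib_left[of 2] low sum ..
  also have "\<dots> = of_nat (Suc (Suc n)) * F * (2 * y + S)"
    by (simp add: algebra_simps)
  finally show ?case
    unfolding F_def S_def fact_Suc[of "Suc n"] of_nat_mult of_nat_id by (simp only: mult_ac)
qed auto

lemma alt_power_sum_Suc_Suc_card:
  "finite N \<Longrightarrow> card N = n \<Longrightarrow>
    24 * alt_power_sum a N (Suc (Suc n)) y
      = of_nat (fact (Suc (Suc n))) * prod a N * (3 * (2 * y + sum a N)\<^sup>2 + (\<Sum>k\<in>N. (a k)\<^sup>2))"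
proof (induction n arbitrary: N y)
  case 0
  then have "N = {}" by simp
  then show ?case by (simp add: power_mult_distrib numeral_2_eq_2[symmetric])
next
  case (Suc n)
  define S Q F where "S = sum a N" and "Q = (\<Sum>k\<in>N. (a k)\<^sup>2)" and "F = of_nat (fact (Suc (Suc n))) * prod a N"
  have *: "24 * (a k * alt_power_sum a (N - {k}) (Suc (Suc n)) (y + a k))
      = F * (3 * (2 * y + S)\<^sup>2 + Q + 6 * (2 * y + S) * a k + 2 * (a k)\<^sup>2)" if k: "k \<in> N" for k
  proof -
    have "24 * (a k * alt_power_sum a (N - {k}) (Suc (Suc n)) (y + a k))
        = a k * (24 * alt_power_sum a (N - {k}) (Suc (Suc n)) (y + a k))"
      by (rule mult.left_commute)
    also have "\<dots> = a k * (of_nat (fact (Suc (Suc n))) * prod a (N - {k}) *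
        (3 * (2 * (y + a k) + sum a (N - {k}))\<^sup>2 + (\<Sum>k\<in>N - {k}. (a k)\<^sup>2)))"
      using Suc.IH[of "N - {k}"] Suc.prems k by (simp only: finite_Diff card_Diff_singleton diff_Suc_1)
    also have "\<dots> = of_nat (fact (Suc (Suc n))) * (a k * prod a (N - {k})) *
        (3 * (2 * (y + a k) + sum a (N - {k}))\<^sup>2 + (\<Sum>k\<in>N - {k}. (a k)\<^sup>2))"
      by (simp only: mult_ac)
    also have "a k * prod a (N - {k}) = prod a N"
      using Suc.prems(1) k by (simp add: prod.remove)
    also have "sum a (N - {k}) = S - a k"
      unfolding S_def using Suc.prems(1) k by (simp add: sum_diff1)
    also have "(\<Sum>k\<in>N - {k}. (a k)\<^sup>2) = Q - (a k)\<^sup>2"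
      unfolding Q_def using Suc.prems(1) k by (simp add: sum_diff1)
    also have "3 * (2 * (y + a k) + (S - a k))\<^sup>2 + (Q - (a k)\<^sup>2)
      = 3 * (2 * y + S)\<^sup>2 + Q + 6 * (2 * y + S) * a k + 2 * (a k)\<^sup>2"
      by (simp add: power2_eq_square algebra_simps)
    finally show ?thesis unfolding F_def .
  qed
  have "24 * (\<Sum>k\<in>N. a k * alt_power_sum a (N - {k}) (Suc (Suc n)) (y + a k))
      = F * (\<Sum>k\<in>N. 3 * (2 * y + S)\<^sup>2 + Q + 6 * (2 * y + S) * a k + 2 * (a k)\<^sup>2)"
    unfolding sum_distrib_left using * by (intro sum.cong) auto
  also have "(\<Sum>k\<in>N. 3 * (2 * y + S)\<^sup>2 + Q + 6 * (2 * y + S) * a k + 2 * (a k)\<^sup>2)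
      = of_nat (Suc n) * (3 * (2 * y + S)\<^sup>2 + Q) + 6 * (2 * y + S) * S + 2 * Q"
    using Suc.prems by (simp add: sum.distrib sum_distrib_left[symmetric] S_def Q_def)
  finally have sum: "24 * (\<Sum>k\<in>N. a k * alt_power_sum a (N - {k}) (Suc (Suc n)) (y + a k))
      = F * (of_nat (Suc n) * (3 * (2 * y + S)\<^sup>2 + Q) + 6 * (2 * y + S) * S + 2 * Q)" .
  have "2 * alt_power_sum a N (Suc (Suc n)) y = F * (2 * y + S)"
    unfolding F_def S_def by (rule alt_power_sum_Suc_card) (use Suc.prems in auto)
  \<comment> \<open>The factor \<open>12 * y\<close> brings the multiplier 2 of the lower
    coefficient up to the common 24.\<close>
  then have "12 * y * (2 * alt_power_sum a N (Suc (Suc n)) y) = 12 * y * (F * (2 * y + S))"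
    by simp
  then have low: "24 * (y * alt_power_sum a N (Suc (Suc n)) y) = F * (12 * y * (2 * y + S))"
    by (simp add: mult_ac)
  have "24 * alt_power_sum a N (Suc (Suc (Suc n))) y
      = F * (12 * y * (2 * y + S)
          + (of_nat (Suc n) * (3 * (2 * y + S)\<^sup>2 + Q) + 6 * (2 * y + S) * S + 2 * Q))"
    unfolding alt_power_sum_Suc[OF Suc.prems(1), of _ "Suc (Suc n)"] distrib_left[of 24] low sum
    by (simp only: distrib_left)
  also have "\<dots> = of_nat (Suc (Suc (Suc n))) * F * (3 * (2 * y + S)\<^sup>2 + Q)"
    by (simp add: power2_eq_square algebra_simps)
  finally show ?case
    unfolding F_def S_def Q_def fact_Suc[of "Suc (Suc n)"] of_nat_mult of_nat_id by (simp only: mult_ac)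
qed

section \<open>Relations implied by zero sums\<close>

lemma fact_mod_ring_neq_0:
  assumes "n < CARD('p)"
  shows "(of_nat (fact n) :: 'p::prime_card mod_ring) \<noteq> 0"
proof
  assume "of_nat (fact n) = (0 :: 'p mod_ring)"
  then have "CARD('p) dvd fact n" by (rule of_nat_0_mod_ring_dvd)
  then show False using assms by (simp add: prime_dvd_fact_iff[OF prime_card])
qed

lemma of_nat_mod_ring_neq_0:
  "0 < n \<Longrightarrow> n < CARD('p) \<Longrightarrow> (of_nat n :: 'p::prime_card mod_ring) \<noteq> 0"
  using of_nat_0_mod_ring_dvd nat_dvd_not_less by blast

lemma power_mod_ring_card_minus_1:
  fixes x :: "'p::prime_card mod_ring"
  assumes "x \<noteq> 0"
  shows "x ^ (CARD('p) - 1) = 1"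
proof -
  have "x * x ^ (CARD('p) - 1) = x ^ CARD('p)"
    by (simp flip: power_Suc)
  also have "\<dots> = x * 1"
    using finite_field_power_card_eq_same[of x] by simp
  finally show ?thesis using assms by simp
qed

text \<open>The coefficients of the linear form that vanishes on zero-sum sets are written as \<open>a k * c k\<close>.\<close>

locale zero_sum_relation =
  fixes X :: "'i set" and a c :: "'i \<Rightarrow> 'p::prime_card mod_ring"
  assumes finite_X: "finite X" and card_X: "card X = CARD('p)"
    and nonzero: "\<And>k. k \<in> X \<Longrightarrow> a k \<noteq> 0"
    and relation: "\<And>I. I \<subseteq> X \<Longrightarrow> sum a I = 0 \<Longrightarrow> (\<Sum>k\<in>I. a k * c k) = 0"
begin

text \<open>Multiples of \<open>a\<close> vanish on zero-sum sets, so \<open>c\<close> matters only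
  up to an additive constant.\<close>

lemma shift: "zero_sum_relation X a (\<lambda>k. c k - l)"
proof
  fix I assume I: "I \<subseteq> X" "sum a I = 0"
  have "(\<Sum>k\<in>I. a k * (c k - l)) = (\<Sum>k\<in>I. a k * c k) - sum a I * l"
    by (simp add: right_diff_distrib sum_subtractf sum_distrib_right)
  then show "(\<Sum>k\<in>I. a k * (c k - l)) = 0" using relation[OF I] I by simp
qed (simp_all add: finite_X card_X nonzero)

text \<open>By Fermat the weight \<open>(sum a I) ^ (CARD('p) - 1)\<close> changes no value of the
  linear form, so the exponent may be replaced by 0, where the alternating sum vanishes.\<close>

lemma alt_power_sum_relation:
  assumes M: "M \<subseteq> X" "2 \<le> card M"
  shows "(\<Sum>k\<in>M. a k * c k * alt_power_sum a (M - {k}) (CARD('p) - 1) (a k)) = 0"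
proof -
  have fin: "finite M" using M finite_X finite_subset by blast
  have "alt_sum M (\<lambda>I. (\<Sum>k\<in>I. a k * c k) * (0 + sum a I) ^ (CARD('p) - 1))
      = alt_sum M (\<lambda>I. (\<Sum>k\<in>I. a k * c k) * (0 + sum a I) ^ 0)"
  proof (rule alt_sum_cong)
    fix I assume "I \<subseteq> M"
    \<comment> \<open>If \<open>sum a I = 0\<close>, both sides vanish by \<open>relation\<close>;
      otherwise the power is 1.\<close>
    then show "(\<Sum>k\<in>I. a k * c k) * (0 + sum a I) ^ (CARD('p) - 1)
        = (\<Sum>k\<in>I. a k * c k) * (0 + sum a I) ^ 0"
      using relation[of I] M(1) power_mod_ring_card_minus_1[of "sum a I"]
      by (cases "sum a I = 0") auto
  qed
  also have "\<dots> = (\<Sum>k\<in>M. a k * c k * alt_power_sum a (M - {k}) 0 (0 + a k))"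
    by (rule alt_sum_weighted[OF fin])
  also have "\<dots> = 0"
    \<comment> \<open>Each \<open>M - {k}\<close> is nonempty, so the exponent 0 is below its
      size.\<close>
    using M(2) fin by (intro sum.neutral ballI) (simp add: alt_power_sum_eq_0)
  finally show ?thesis
    unfolding alt_sum_weighted[OF fin] by simp
qed

lemma prod_nonzero: "M \<subseteq> X \<Longrightarrow> prod a M \<noteq> 0"
  using finite_X nonzero by (metis finite_subset prod_zero_iff subsetD)

lemma fact_nonzero: "(of_nat (fact (CARD('p) - 1)) :: 'p mod_ring) \<noteq> 0"
  by (rule fact_mod_ring_neq_0) (simp add: prime_gt_0_nat[OF prime_card])

text \<open>As \<open>a k * prod a (M - {k}) = prod a M\<close>, all terms share the nonzero factor
  \<open>fact (CARD('p) - 1) * prod a M\<close>, which cancels. The multiplier \<open>q\<close>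
  clears the denominators 1, 2 or 24 and is never divided by.\<close>

lemma moment:
  assumes M: "M \<subseteq> X" "2 \<le> card M"
    and h: "\<And>k. k \<in> M \<Longrightarrow> q * alt_power_sum a (M - {k}) (CARD('p) - 1) (a k)
      = of_nat (fact (CARD('p) - 1)) * prod a (M - {k}) * h k"
  shows "(\<Sum>k\<in>M. c k * h k) = 0"
proof -
  have fin: "finite M" using M finite_X finite_subset by blast
  have "of_nat (fact (CARD('p) - 1)) * prod a M * (c k * h k)
      = q * (a k * c k * alt_power_sum a (M - {k}) (CARD('p) - 1) (a k))" if k: "k \<in> M" for k
    unfolding prod.remove[OF fin k] using h[OF k] by (simp add: mult_ac)
  then have "of_nat (fact (CARD('p) - 1)) * prod a M * (\<Sum>k\<in>M. c k * h k)
      = q * (\<Sum>k\<in>M. a k * c k * alt_power_sum a (M - {k}) (CARD('p) - 1) (a k))"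
    unfolding sum_distrib_left by (intro sum.cong) auto
  also have "\<dots> = 0"
    unfolding alt_power_sum_relation[OF M] by simp
  finally show ?thesis
    using fact_nonzero prod_nonzero[OF M(1)] by simp
qed

text \<open>\<open>moment\<close> with \<open>M = X\<close>: the sets \<open>X - {k}\<close> have p
  - 1 elements, so only leading coefficients occur.\<close>

lemma sum_c: "sum c X = 0"
proof -
  have "(\<Sum>k\<in>X. c k * 1) = 0"
  proof (rule moment)
    show "2 \<le> card X" using card_X prime_ge_2_nat[OF prime_card[where 'a='p]] by simp
    fix k assume "k \<in> X"
    then have "alt_power_sum a (X - {k}) (CARD('p) - 1) (a k) = of_nat (fact (CARD('p) - 1)) * prod a (X - {k})"
      by (intro alt_power_sum_card) (auto simp: finite_X card_X)
    then show "1 * alt_power_sum a (X - {k}) (CARD('p) - 1) (a k)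
        = of_nat (fact (CARD('p) - 1)) * prod a (X - {k}) * 1" by simp
  qed simp
  then show ?thesis by simp
qed

text \<open>\<open>moment\<close> with \<open>M = X - {j}\<close>: the exponent p - 1 exceeds the
  size of \<open>M - {k}\<close> by one, so the second coefficient enters.\<close>

lemma sum_ac:
  assumes p: "2 < CARD('p)" and j: "j \<in> X"
  shows "(\<Sum>k\<in>X. a k * c k) = sum a X * c j"
proof -
  define M where "M = X - {j}"
  have M: "M \<subseteq> X" "card M = CARD('p) - 1" "finite M"
    using j finite_X card_X by (auto simp: M_def)
  have "(\<Sum>k\<in>M. c k * (sum a M + a k)) = 0"
  proof (rule moment)
    fix k assume k: "k \<in> M"
    have p': "Suc (CARD('p) - 2) = CARD('p) - 1" using p by simp
    have "2 * alt_power_sum a (M - {k}) (Suc (CARD('p) - 2)) (a k)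
        = of_nat (fact (Suc (CARD('p) - 2))) * prod a (M - {k}) * (2 * a k + sum a (M - {k}))"
      by (rule alt_power_sum_Suc_card) (use M k in auto)
    then show "2 * alt_power_sum a (M - {k}) (CARD('p) - 1) (a k)
        = of_nat (fact (CARD('p) - 1)) * prod a (M - {k}) * (sum a M + a k)"
      unfolding p' by (simp add: sum.remove[OF M(3) k] add_ac)
  qed (use M p in auto)
  then have "sum c M * sum a M + (\<Sum>k\<in>M. a k * c k) = 0"
    by (simp add: distrib_left sum.distrib sum_distrib_right[symmetric] mult.commute)
  then have "(sum c X - c j) * (sum a X - a j) + ((\<Sum>k\<in>X. a k * c k) - a j * c j) = 0"
    unfolding M_def using j finite_X by (simp add: sum_diff1)
  then show ?thesis
    unfolding sum_c by (simp add: algebra_simps)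
qed

text \<open>\<open>moment\<close> with two indices removed: the third coefficient enters, and with
  it the squares. As \<open>sum a X = 0\<close>, the sums of \<open>a k\<close>, \<open>c k\<close>
  and \<open>a k * c k\<close> over \<open>X\<close> all vanish, so that only \<open>Q\<close>,
  \<open>W\<close> and the terms at \<open>i\<close> and \<open>j\<close> remain.\<close>

lemma pair_relation:
  assumes p: "3 < CARD('p)" and s: "sum a X = 0" and ij: "i \<in> X" "j \<in> X" "i \<noteq> j"
  shows "2 * (c i - c j) * ((a i)\<^sup>2 - (a j)\<^sup>2)
    = (\<Sum>k\<in>X. (a k)\<^sup>2) * (c i + c j) - 2 * (\<Sum>k\<in>X. (a k)\<^sup>2 * c k)"
proof -
  define M where "M = X - {i} - {j}"
  define Q W where "Q = (\<Sum>k\<in>X. (a k)\<^sup>2)" and "W = (\<Sum>k\<in>X. (a k)\<^sup>2 * c k)"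
  have M: "M \<subseteq> X" "card M = CARD('p) - 2" "finite M"
    using ij finite_X card_X by (auto simp: M_def)
  have sum_M: "sum f M = sum f X - f i - f j" for f :: "'i \<Rightarrow> 'p mod_ring"
    unfolding M_def using ij finite_X by (simp add: sum_diff1)
  have "(\<Sum>k\<in>M. c k * (3 * (sum a M + a k)\<^sup>2 + ((\<Sum>k\<in>M. (a k)\<^sup>2) - (a k)\<^sup>2))) = 0"
  proof (rule moment)
    fix k assume k: "k \<in> M"
    have p': "Suc (Suc (CARD('p) - 3)) = CARD('p) - 1" using p by simp
    have "24 * alt_power_sum a (M - {k}) (Suc (Suc (CARD('p) - 3))) (a k)
        = of_nat (fact (Suc (Suc (CARD('p) - 3)))) * prod a (M - {k})
          * (3 * (2 * a k + sum a (M - {k}))\<^sup>2 + (\<Sum>k\<in>M - {k}. (a k)\<^sup>2))"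
      by (rule alt_power_sum_Suc_Suc_card) (use M k p in auto)
    also have "2 * a k + sum a (M - {k}) = sum a M + a k"
      by (simp add: sum.remove[OF M(3) k])
    also have "(\<Sum>k\<in>M - {k}. (a k)\<^sup>2) = (\<Sum>k\<in>M. (a k)\<^sup>2) - (a k)\<^sup>2"
      using M(3) k by (simp add: sum_diff1)
    finally show "24 * alt_power_sum a (M - {k}) (CARD('p) - 1) (a k)
        = of_nat (fact (CARD('p) - 1)) * prod a (M - {k})
          * (3 * (sum a M + a k)\<^sup>2 + ((\<Sum>k\<in>M. (a k)\<^sup>2) - (a k)\<^sup>2))"
      unfolding p' .
  qed (use M p in auto)
  also have "(\<Sum>k\<in>M. c k * (3 * (sum a M + a k)\<^sup>2 + ((\<Sum>k\<in>M. (a k)\<^sup>2) - (a k)\<^sup>2)))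
      = (\<Sum>k\<in>M. (3 * (sum a M)\<^sup>2 + (\<Sum>k\<in>M. (a k)\<^sup>2)) * c k + 6 * sum a M * (a k * c k)
          + 2 * ((a k)\<^sup>2 * c k))"
    by (intro sum.cong refl) (simp add: power2_eq_square algebra_simps)
  also have "\<dots> = (3 * (sum a M)\<^sup>2 + (\<Sum>k\<in>M. (a k)\<^sup>2)) * sum c M
      + 6 * sum a M * (\<Sum>k\<in>M. a k * c k) + 2 * (\<Sum>k\<in>M. (a k)\<^sup>2 * c k)"
    by (simp only: sum.distrib sum_distrib_left)
  finally have "(3 * (a i + a j)\<^sup>2 + (Q - (a i)\<^sup>2 - (a j)\<^sup>2)) * (- c i - c j)
      + 6 * (- a i - a j) * (- (a i * c i) - a j * c j) + 2 * (W - (a i)\<^sup>2 * c i - (a j)\<^sup>2 * c j) = 0"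
    (is "?E = 0")
    using sum_ac[of i] p ij(1)
    unfolding sum_M sum_c s Q_def[symmetric] W_def[symmetric]
    by (simp add: power2_eq_square algebra_simps)
  \<comment> \<open>All terms with \<open>a i * a j\<close> cancel.\<close>
  moreover have "?E = 2 * (c i - c j) * ((a i)\<^sup>2 - (a j)\<^sup>2) - (Q * (c i + c j) - 2 * W)"
    by (simp add: power2_eq_square algebra_simps)
  ultimately have "2 * (c i - c j) * ((a i)\<^sup>2 - (a j)\<^sup>2) = Q * (c i + c j) - 2 * W"
    by simp
  then show ?thesis unfolding Q_def W_def .
qed

end

section \<open>Solving the relations for the coefficients\<close>

lemma two_neq_0_mod_ring: "2 < CARD('p) \<Longrightarrow> (2 :: 'p::prime_card mod_ring) \<noteq> 0"
  using of_nat_mod_ring_neq_0[of 2, where 'p='p] by simp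

lemma double_eq_0_mod_ring:
  fixes x :: "'p::prime_card mod_ring"
  assumes "2 < CARD('p)" "x + x = 0"
  shows "x = 0"
  using assms two_neq_0_mod_ring by (metis mult_2 mult_eq_0_iff)

text \<open>With t values \<open>r\<close> and p - t values \<open>- r\<close> the sum is
  \<open>2 t r\<close>. Hence p divides t, so t is 0 or p.\<close>

lemma constant_if_constant_square:
  fixes a :: "'i \<Rightarrow> 'p::prime_card mod_ring"
  assumes fin: "finite X" and card: "card X = CARD('p)" and p: "2 < CARD('p)"
    and sum: "sum a X = 0" and sq: "\<And>k. k \<in> X \<Longrightarrow> (a k)\<^sup>2 = r\<^sup>2" and r: "r \<noteq> 0"
  shows "\<exists>r. \<forall>k\<in>X. a k = r"
proof -
  define T where "T = {k\<in>X. a k = r}"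
  have T: "T \<subseteq> X" "finite T" using fin by (auto simp: T_def)
  have "sum a X = sum a T + sum a (X - T)"
    using T fin by (simp add: sum.subset_diff add.commute)
  also have "sum a T = of_nat (card T) * r"
    by (simp add: T_def)
  also have "sum a (X - T) = (\<Sum>k\<in>X - T. - r)"
    by (intro sum.cong refl) (use sq in \<open>auto simp: T_def power2_eq_iff\<close>)
  also have "\<dots> = (of_nat (card T) - of_nat (CARD('p))) * r"
    using T fin card by (simp add: card_Diff_subset of_nat_diff card_mono[of X T, unfolded card] algebra_simps)
  finally have "(of_nat (card T) + of_nat (card T)) * r = 0"
    using sum by (simp add: algebra_simps)
  then have "of_nat (card T) = (0 :: 'p mod_ring)"
    using r p double_eq_0_mod_ring by (metis mult_eq_0_iff)
  then have "CARD('p) dvd card T"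
    by (rule of_nat_0_mod_ring_dvd)
  moreover have "card T \<le> CARD('p)"
    using card_mono[OF fin T(1)] card by simp
  ultimately have "card T = 0 \<or> card T = CARD('p)"
    using dvd_imp_le by fastforce
  then have "T = {} \<or> T = X"
    using T fin card card_subset_eq[OF fin T(1)] by auto
  then show ?thesis
    using sq by (auto simp: T_def power2_eq_iff)
qed

context zero_sum_relation
begin

text \<open>Pigeonhole: p indices, but only p - 1 nonzero values.\<close>

lemma repeated_value:
  obtains i j where "i \<in> X" "j \<in> X" "i \<noteq> j" "a i = a j"
proof -
  have "\<not> inj_on a X"
  proof
    assume "inj_on a X"
    then have "CARD('p) = card (a ` X)" using card_X by (simp add: card_image)
    also have "\<dots> \<le> card (UNIV - {0 :: 'p mod_ring})"
      by (rule card_mono) (use nonzero in auto)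
    also have "\<dots> < CARD('p)" by (simp add: card_Diff_singleton)
    finally show False by simp
  qed
  then show ?thesis using that unfolding inj_on_def by blast
qed

text \<open>The witness is \<open>l = W / Q\<close>: centring \<open>c\<close> at it absorbs the
  term \<open>2 * W\<close>.\<close>

lemma normalized_pair_relation:
  assumes p: "3 < CARD('p)" and s: "sum a X = 0" and Q: "(\<Sum>k\<in>X. (a k)\<^sup>2) \<noteq> 0"
  obtains l where "\<And>i j. i \<in> X \<Longrightarrow> j \<in> X \<Longrightarrow> i \<noteq> j \<Longrightarrow>
    2 * (c i - c j) * ((a i)\<^sup>2 - (a j)\<^sup>2) = (\<Sum>k\<in>X. (a k)\<^sup>2) * ((c i - l) + (c j - l))"
proof
  define Q W where "Q = (\<Sum>k\<in>X. (a k)\<^sup>2)" and "W = (\<Sum>k\<in>X. (a k)\<^sup>2 * c k)"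
  fix i j assume "i \<in> X" "j \<in> X" "i \<noteq> j"
  then have "2 * (c i - c j) * ((a i)\<^sup>2 - (a j)\<^sup>2) = Q * (c i + c j) - 2 * W"
    unfolding Q_def W_def by (rule pair_relation[OF p s])
  also have "\<dots> = Q * ((c i - W / Q) + (c j - W / Q))"
    using Q unfolding Q_def[symmetric] by (simp add: field_simps)
  finally show "2 * (c i - c j) * ((a i)\<^sup>2 - (a j)\<^sup>2)
    = (\<Sum>k\<in>X. (a k)\<^sup>2) * ((c i - W / Q) + (c j - W / Q))" unfolding Q_def .
qed

text \<open>The condition involves \<open>a\<close> only, so a pair found through one
  \<open>c\<close> constrains every other. For odd p it makes all squares outside the pair equal,
  and different from the square of \<open>a i\<close>.\<close>

definition exceptional_pair :: "'i \<Rightarrow> 'i \<Rightarrow> bool" where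
  "exceptional_pair i j \<longleftrightarrow> i \<in> X \<and> j \<in> X \<and> i \<noteq> j \<and> a i = a j \<and>
    (\<Sum>k\<in>X. (a k)\<^sup>2) \<noteq> 0 \<and>
    (\<forall>k\<in>X - {i, j}. 2 * ((a k)\<^sup>2 - (a i)\<^sup>2) = - (\<Sum>k\<in>X. (a k)\<^sup>2))"

text \<open>Pairs with equal squares lose the left side of \<open>pair_relation\<close>, and
  \<open>repeated_value\<close> supplies such a pair. The cases are whether \<open>Q\<close>
  vanishes and, if not, whether \<open>c\<close> leaves the centre \<open>l\<close> on some pair
  with equal squares.\<close>

lemma exceptional_pair_or_constant:
  assumes p: "3 < CARD('p)" and s: "sum a X = 0"
    and nonconst: "\<nexists>r. \<forall>k\<in>X. a k = r"
  shows "(\<exists>l. \<forall>k\<in>X. c k = l) \<or>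
    (\<exists>i j l. exceptional_pair i j \<and> c i \<noteq> l \<and> c i + c j = 2 * l \<and> (\<forall>k\<in>X - {i, j}. c k = l))"
proof -
  define Q where "Q = (\<Sum>k\<in>X. (a k)\<^sup>2)"
  have dbl: "x + x = 0 \<Longrightarrow> x = 0" for x :: "'p mod_ring"
    using double_eq_0_mod_ring[of x] p by simp
  have X0: "X \<noteq> {}" using card_X by auto
  show ?thesis
  proof (cases "Q = 0")
    case True
    define W where "W = (\<Sum>k\<in>X. (a k)\<^sup>2 * c k)"
    have rel: "2 * ((c i - c j) * ((a i)\<^sup>2 - (a j)\<^sup>2) + W) = 0" if "i \<in> X" "j \<in> X" "i \<noteq> j" for i j
      using pair_relation[OF p s that] True unfolding Q_def[symmetric] W_def[symmetric]
      by (simp add: algebra_simps)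
    then have rel: "(c i - c j) * ((a i)\<^sup>2 - (a j)\<^sup>2) + W = 0" if "i \<in> X" "j \<in> X" "i \<noteq> j" for i j
      using that two_neq_0_mod_ring[where 'p='p] p by (metis Suc_lessD eval_nat_numeral(3) mult_eq_0_iff)
    obtain i j where "i \<in> X" "j \<in> X" "i \<noteq> j" "a i = a j"
      by (rule repeated_value)
    \<comment> \<open>At a repeated value the first term of \<open>rel\<close> is zero.\<close>
    with rel[of i j] have "W = 0" by simp
    then have rel: "c i = c j \<or> (a i)\<^sup>2 = (a j)\<^sup>2" if "i \<in> X" "j \<in> X" for i j
      using rel[OF that] by (cases "i = j") auto
    obtain i0 where i0: "i0 \<in> X" using X0 by auto
    have "\<exists>m\<in>X. (a m)\<^sup>2 \<noteq> (a i0)\<^sup>2"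
    proof (rule ccontr)
      assume "\<not> ?thesis"
      then have sq: "(a k)\<^sup>2 = (a i0)\<^sup>2" if "k \<in> X" for k using that by blast
      have "2 < CARD('p)" using p by simp
      then have "\<exists>r. \<forall>k\<in>X. a k = r"
        by (rule constant_if_constant_square[OF finite_X card_X _ s sq nonzero[OF i0]])
      then show False using nonconst by simp
    qed
    then obtain m where m: "m \<in> X" "(a m)\<^sup>2 \<noteq> (a i0)\<^sup>2" by auto
    \<comment> \<open>If \<open>k\<close> and \<open>i0\<close> have the same square, they are
      compared through \<open>m\<close>.\<close>
    have "c k = c i0" if "k \<in> X" for k
      using rel[OF that i0] rel[OF that m(1)] rel[OF m(1) i0] m(2) by metis
    then show ?thesis by blast
  next
    case False
    then obtain l where l: "\<And>i j. i \<in> X \<Longrightarrow> j \<in> X \<Longrightarrow> i \<noteq> j \<Longrightarrow>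
        2 * (c i - c j) * ((a i)\<^sup>2 - (a j)\<^sup>2) = Q * ((c i - l) + (c j - l))"
      using normalized_pair_relation[OF p s] unfolding Q_def by metis
    define d where "d k = c k - l" for k
    have rel: "2 * (d i - d j) * ((a i)\<^sup>2 - (a j)\<^sup>2) = Q * (d i + d j)"
      if "i \<in> X" "j \<in> X" "i \<noteq> j" for i j
      using l[OF that] by (simp add: d_def)
    have opp: "d j = - d i" if "i \<in> X" "j \<in> X" "i \<noteq> j" "(a i)\<^sup>2 = (a j)\<^sup>2" for i j
      using rel[OF that(1-3)] that(4) False by (simp add: add_eq_0_iff)
    have sum_d: "sum d X = 0"
      using sum_c card_X by (simp add: d_def sum_subtractf)
    show ?thesis
    proof (cases "\<exists>i\<in>X. \<exists>j\<in>X. i \<noteq> j \<and> (a i)\<^sup>2 = (a j)\<^sup>2 \<and> d i \<noteq> 0")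
      case True
      then obtain i j where ij: "i \<in> X" "j \<in> X" "i \<noteq> j" "(a i)\<^sup>2 = (a j)\<^sup>2" "d i \<noteq> 0"
        by blast
      have dj: "d j = - d i" using ij(1-4) by (rule opp)
      \<comment> \<open>Compare \<open>k\<close> with both \<open>i\<close> and \<open>j\<close>,
        where \<open>d\<close> takes opposite values. The difference of the two relations gives
        \<open>D = - Q\<close>, and the first one then gives \<open>d k = 0\<close>.\<close>
      have other: "d k = 0 \<and> 2 * ((a k)\<^sup>2 - (a i)\<^sup>2) = - Q" if k: "k \<in> X - {i, j}" for k
      proof -
        define D where "D = 2 * ((a k)\<^sup>2 - (a i)\<^sup>2)"
        have k': "k \<in> X" "k \<noteq> i" "k \<noteq> j" using k by auto
        have e1: "(d k - d i) * D = Q * (d k + d i)"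
          using rel[OF k'(1) ij(1) k'(2)] by (simp only: D_def mult_ac)
        have e2: "(d k + d i) * D = Q * (d k - d i)"
          using rel[OF k'(1) ij(2) k'(3)] unfolding dj ij(4)[symmetric] diff_minus_eq_add add_uminus_conv_diff
          by (simp only: D_def mult_ac)
        have "d i * (D + Q) + d i * (D + Q)
            = ((d k + d i) * D - (d k - d i) * D) - (Q * (d k - d i) - Q * (d k + d i))"
          by (simp add: algebra_simps)
        also have "\<dots> = 0" unfolding e1 e2 by simp
        finally have "d i * (D + Q) = 0" by (rule dbl)
        then have D: "D = - Q" using ij(5) by (simp add: add_eq_0_iff2)
        have "Q * d k + Q * d k = Q * (d k + d i) - (d k - d i) * D"
          unfolding D by (simp add: algebra_simps)
        then have "Q * d k + Q * d k = 0" unfolding e1 by simp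
        then have "d k = 0" using False dbl by (metis mult_eq_0_iff)
        with D show ?thesis by (simp add: D_def)
      qed
      \<comment> \<open>Only \<open>i\<close> and \<open>j\<close> contribute to this sum, which is
        zero because \<open>sum a X = 0\<close>; equal squares are thus sharpened to equal
        values.\<close>
      have "(\<Sum>k\<in>X. a k * d k) = (\<Sum>k\<in>{i, j}. a k * d k)"
        using ij other by (intro sum.mono_neutral_right finite_X) auto
      also have "\<dots> = (a i - a j) * d i" using ij dj by (simp add: algebra_simps)
      also have "(\<Sum>k\<in>X. a k * d k) = 0"
        using zero_sum_relation.relation[OF shift[of l], of X] s by (simp add: d_def)
      finally have "a i = a j" using ij(5) by simp
      then have "exceptional_pair i j"
        unfolding exceptional_pair_def Q_def[symmetric] using ij other False by auto
      moreover have "c i \<noteq> l" "c i + c j = 2 * l" "\<forall>k\<in>X - {i, j}. c k = l"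
        using ij(5) dj other by (auto simp: d_def algebra_simps)
      ultimately show ?thesis by blast
    next
      case no_pair: False
      \<comment> \<open>Here equal squares at distinct indices force \<open>d\<close> to vanish
        there. As \<open>d\<close> sums to zero, one nonzero value brings a second, and comparison
        with a repeated value, where \<open>d\<close> is 0, gives both the same square: a
        contradiction.\<close>
      have "d k = 0" if k: "k \<in> X" for k
      proof (rule ccontr)
        assume dk: "d k \<noteq> 0"
        obtain i j where ij: "i \<in> X" "j \<in> X" "i \<noteq> j" "a i = a j"
          by (rule repeated_value)
        then have "(a i)\<^sup>2 = (a j)\<^sup>2" by simp
        then have di: "d i = 0" using no_pair ij by blast
        have sq: "2 * ((a m)\<^sup>2 - (a i)\<^sup>2) = Q" if "m \<in> X" "d m \<noteq> 0" for m
          using rel[OF that(1) ij(1)] that di by auto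
        have "\<exists>m\<in>X - {k}. d m \<noteq> 0"
        proof (rule ccontr)
          assume "\<not> ?thesis"
          then have "sum d (X - {k}) = 0" by simp
          then show False using sum_d dk by (simp add: sum.remove[OF finite_X k])
        qed
        then obtain m where m: "m \<in> X" "m \<noteq> k" "d m \<noteq> 0" by auto
        have "2 * ((a m)\<^sup>2 - (a i)\<^sup>2) = 2 * ((a k)\<^sup>2 - (a i)\<^sup>2)"
          using sq m k dk by simp
        then have "(a m)\<^sup>2 = (a k)\<^sup>2"
          using two_neq_0_mod_ring[where 'p='p] p by simp
        then show False using no_pair m k by blast
      qed
      then have "\<forall>k\<in>X. c k = l" by (simp add: d_def)
      then show ?thesis by blast
    qed
  qed
qed

text \<open>Outside the pair all squares agree, so the deviations \<open>c k - l\<close> are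
  pairwise opposite; three indices force them to be 0.\<close>

lemma exceptional_pair_relation:
  assumes p: "3 < CARD('p)" and s: "sum a X = 0" and ij: "exceptional_pair i j"
  obtains l where "\<forall>k\<in>X - {i, j}. c k = l" "c i + c j = 2 * l"
proof -
  define Q where "Q = (\<Sum>k\<in>X. (a k)\<^sup>2)"
  have dbl: "x + x = 0 \<Longrightarrow> x = 0" for x :: "'p mod_ring"
    using double_eq_0_mod_ring[of x] p by simp
  have Q: "Q \<noteq> 0" using ij by (simp add: exceptional_pair_def Q_def)
  then obtain l where l: "\<And>i j. i \<in> X \<Longrightarrow> j \<in> X \<Longrightarrow> i \<noteq> j \<Longrightarrow>
      2 * (c i - c j) * ((a i)\<^sup>2 - (a j)\<^sup>2) = Q * ((c i - l) + (c j - l))"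
    using normalized_pair_relation[OF p s] unfolding Q_def by metis
  have opp: "(c i - l) + (c j - l) = 0" if "i \<in> X" "j \<in> X" "i \<noteq> j" "(a i)\<^sup>2 = (a j)\<^sup>2" for i j
    using l[OF that(1-3)] that(4) Q by simp
  have sq: "(a k)\<^sup>2 = (a m)\<^sup>2" if "k \<in> X - {i, j}" "m \<in> X - {i, j}" for k m
  proof -
    have "2 * ((a k)\<^sup>2 - (a i)\<^sup>2) = 2 * ((a m)\<^sup>2 - (a i)\<^sup>2)"
      using ij that unfolding exceptional_pair_def by metis
    then show ?thesis using two_neq_0_mod_ring[where 'p='p] p by simp
  qed
  have "c k = l" if k: "k \<in> X - {i, j}" for k
  proof -
    \<comment> \<open>A prime above 3 is at least 5, so besides \<open>k\<close> two more indices
      lie outside the pair.\<close>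
    have "CARD('p) \<noteq> 4" using prime_card[where 'a='p] prime_odd_nat[of "CARD('p)"] by auto
    then have "2 \<le> card (X - {i, j, k})"
      using ij k card_X p finite_X by (auto simp: exceptional_pair_def card_Diff_subset)
    then obtain m n where mn: "m \<in> X - {i, j, k}" "n \<in> X - {i, j, k}" "m \<noteq> n"
      by (meson card_2_iff' obtain_subset_with_card_n subsetD)
    have "(c k - l) + (c m - l) = 0" "(c k - l) + (c n - l) = 0" "(c m - l) + (c n - l) = 0"
      by (rule opp; use mn k in \<open>auto intro: sq\<close>)+
    then have "(c k - l) + (c k - l) = 0"
      by (metis add.commute add_left_cancel)
    then show ?thesis using dbl[of "c k - l"] by simp
  qed
  moreover have "c i + c j = 2 * l"
    using opp[of i j] ij by (auto simp: exceptional_pair_def algebra_simps)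
  ultimately show ?thesis using that by blast
qed

text \<open>If \<open>sum a X\<close> is nonzero, \<open>sum_ac\<close> makes \<open>c\<close>
  constant. For p = 2 every \<open>a k\<close> is 1; for p = 3 every square is 1, which with sum
  zero makes \<open>a\<close> constant.\<close>

lemma nonconstant_imp_exceptional_pair:
  assumes a: "\<nexists>r. \<forall>k\<in>X. a k = r" and c: "\<nexists>l. \<forall>k\<in>X. c k = l"
  shows "3 < CARD('p)" "sum a X = 0" "\<exists>i j l. exceptional_pair i j \<and> c i \<noteq> l \<and> c i + c j = 2 * l \<and> (\<forall>k\<in>X - {i, j}. c k = l)"
proof -
  have p2: "CARD('p) \<noteq> 2"
  proof
    assume "CARD('p) = 2"
    then have "\<forall>k\<in>X. a k = 1"
      using power_mod_ring_card_minus_1[OF nonzero] by simp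
    then show False using a by blast
  qed
  then have p: "2 < CARD('p)" using prime_ge_2_nat[OF prime_card[where 'a='p]] by simp
  show s: "sum a X = 0"
  proof (rule ccontr)
    assume "sum a X \<noteq> 0"
    then have "\<forall>k\<in>X. c k = (\<Sum>k\<in>X. a k * c k) / sum a X"
      using sum_ac[OF p] by simp
    then show False using c by blast
  qed
  have "CARD('p) \<noteq> 3"
  proof
    assume "CARD('p) = 3"
    then have "(a k)\<^sup>2 = 1\<^sup>2" if "k \<in> X" for k
      using power_mod_ring_card_minus_1[OF nonzero[OF that]] by simp
    then show False
      using constant_if_constant_square[OF finite_X card_X p s, of 1] a by simp
  qed
  then show p3: "3 < CARD('p)" using p by simp
  show "\<exists>i j l. exceptional_pair i j \<and> c i \<noteq> l \<and> c i + c j = 2 * l \<and> (\<forall>k\<in>X - {i, j}. c k = l)"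
    using exceptional_pair_or_constant[OF p3 s a] c by blast
qed

text \<open>Outside the pair the values are \<open>r\<close> and \<open>- r\<close>. Since p - 2 is
  -2 in the field, sum zero reads \<open>2 * a i + (2 * t + 2) * r = 0\<close> with
  \<open>t = card T\<close>.\<close>

lemma exceptional_pair_values:
  assumes p: "3 < CARD('p)" and s: "sum a X = 0" and ij: "exceptional_pair i j"
  obtains T r where "T \<subseteq> X - {i, j}" "T \<noteq> {}" "T \<noteq> X - {i, j}" "r \<noteq> 0"
    "\<forall>k\<in>T. a k = r" "\<forall>k\<in>X - {i, j} - T. a k = - r"
    "a i = - ((of_nat (card T) + 1) * r)"
proof -
  have two: "(2 :: 'p mod_ring) \<noteq> 0" using p by (intro two_neq_0_mod_ring) simp
  have ij': "i \<in> X" "j \<in> X" "i \<noteq> j" "a j = a i"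
    using ij by (auto simp: exceptional_pair_def)
  define Y where "Y = X - {i, j}"
  have card_Y: "card Y + 2 = CARD('p)" and fin_Y: "finite Y"
    using ij' card_X finite_X p by (auto simp: Y_def card_Diff_subset)
  then have "card Y \<noteq> 0" using p by linarith
  then obtain k0 where k0: "k0 \<in> Y" by fastforce
  \<comment> \<open>An attained value as \<open>r\<close> makes \<open>T\<close> nonempty.\<close>
  define r where "r = a k0"
  have r: "r \<noteq> 0" using k0 nonzero by (simp add: r_def Y_def)
  have diff: "2 * ((a k)\<^sup>2 - (a i)\<^sup>2) = - (\<Sum>k\<in>X. (a k)\<^sup>2)" if "k \<in> Y" for k
    using ij that unfolding exceptional_pair_def Y_def by blast
  have sq: "(a k)\<^sup>2 = r\<^sup>2" if "k \<in> Y" for k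
  proof -
    have "2 * ((a k)\<^sup>2 - (a i)\<^sup>2) = 2 * (r\<^sup>2 - (a i)\<^sup>2)"
      using diff[OF that] diff[OF k0] by (simp add: r_def)
    then show ?thesis using two by simp
  qed
  have sq_i: "(a i)\<^sup>2 \<noteq> r\<^sup>2"
  proof
    assume "(a i)\<^sup>2 = r\<^sup>2"
    then have "(\<Sum>k\<in>X. (a k)\<^sup>2) = 0" using diff[OF k0] by (simp add: r_def)
    then show False using ij by (simp add: exceptional_pair_def)
  qed
  define T where "T = {k\<in>Y. a k = r}"
  have T: "T \<subseteq> Y" "finite T" using fin_Y by (auto simp: T_def)
  have rest: "a k = - r" if "k \<in> Y - T" for k
    using that sq[of k] by (auto simp: T_def power2_eq_iff)
  have "sum a X = sum a Y + sum a {i, j}"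
    unfolding Y_def by (rule sum.subset_diff) (use ij' finite_X in auto)
  also have "sum a {i, j} = 2 * a i" using ij' by simp
  also have "sum a Y = sum a (Y - T) + sum a T"
    by (rule sum.subset_diff[OF T(1) fin_Y])
  also have "sum a T = of_nat (card T) * r" by (simp add: T_def)
  also have "sum a (Y - T) = (\<Sum>k\<in>Y - T. - r)" using rest by (intro sum.cong) auto
  also have "\<dots> = (of_nat (card T) - of_nat (card Y)) * r"
    using T card_mono[OF fin_Y T(1)] by (simp add: card_Diff_subset of_nat_diff algebra_simps)
  also have "(of_nat (card Y) :: 'p mod_ring) = - 2"
  proof -
    have "of_nat (card Y + 2) = (0 :: 'p mod_ring)" unfolding card_Y by (rule of_nat_card_eq_0)
    then have "of_nat (card Y) + (2 :: 'p mod_ring) = 0" by (simp add: add.commute)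
    then show ?thesis by (simp only: add_eq_0_iff2)
  qed
  finally have "2 * (a i + (of_nat (card T) + 1) * r) = 0"
    using s by (simp add: algebra_simps)
  then have "a i + (of_nat (card T) + 1) * r = 0"
    using two by (simp only: mult_eq_0_iff simp_thms)
  then have ai: "a i = - ((of_nat (card T) + 1) * r)"
    by (simp only: add_eq_0_iff2)
  \<comment> \<open>Otherwise \<open>card T\<close> is -2 in the field and \<open>a i = r\<close>,
    against \<open>sq_i\<close>.\<close>
  have "T \<noteq> Y"
  proof
    assume "T = Y"
    then have "of_nat (card T) = (- 2 :: 'p mod_ring)"
      using \<open>of_nat (card Y) = - 2\<close> by simp
    then have "a i = r" unfolding ai by (simp add: algebra_simps)
    then show False using sq_i by simp
  qed
  moreover have "k0 \<in> T" using k0 by (simp add: T_def r_def)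
  ultimately have "T \<noteq> {}" "T \<noteq> X - {i, j}" by (auto simp: Y_def)
  moreover have "\<forall>k\<in>T. a k = r" "\<forall>k\<in>X - {i, j} - T. a k = - r"
    using rest by (auto simp: T_def Y_def)
  ultimately show ?thesis
    using that T(1) r ai unfolding Y_def by blast
qed

end

section \<open>Dimension of a span and of its orthogonal complement\<close>

context vec_space
begin

lemma dim_span_lin_indpt:
  assumes U: "finite U" "U \<subseteq> carrier_vec n" and indpt: "lin_indpt U"
  shows "vectorspace.dim class_ring (span_vs U) = card U"
  by (rule dim_span) (use assms in \<open>auto simp: maximal_def\<close>)

lemma span_basis_exists:
  assumes S: "finite S" "S \<subseteq> carrier_vec n"
  obtains U where "finite U" "U \<subseteq> carrier_vec n" "lin_indpt U" "span U = span S"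
proof -
  have sub: "submodule class_ring (span S) V" using S span_is_submodule by simp
  have vs: "vectorspace class_ring (span_vs S)"
    using S span_is_subspace subspace_def subspace_is_vs by simp
  obtain U where U: "finite U" "vectorspace.basis class_ring (span_vs S) U"
    using vectorspace.finite_basis_exists[OF vs fin_dim_span] S by auto
  then have US: "U \<subseteq> span S" "LinearCombinations.module.span class_ring (span_vs S) U = span S"
      "\<not> LinearCombinations.module.lin_dep class_ring (span_vs S) U"
    unfolding vectorspace.basis_def[OF vs] by auto
  have "lin_indpt U" "span U = span S"
    using US span_li_not_depend[OF US(1) sub] by auto
  moreover have "U \<subseteq> carrier_vec n"
    using US(1) S span_is_subset2[of S] by auto
  ultimately show ?thesis using U(1) that by blast
qed

lemma mat_kernel_mat_of_rows:
  assumes "set us \<subseteq> carrier_vec n"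
  shows "mat_kernel (mat_of_rows n us) = orthogonal_complement (set us)"
proof -
  have "mat_of_rows n us *\<^sub>v v = 0\<^sub>v (length us) \<longleftrightarrow> (\<forall>y\<in>set us. v \<bullet> y = 0)"
    if v: "v \<in> carrier_vec n" for v
  proof -
    have "mat_of_rows n us *\<^sub>v v = 0\<^sub>v (length us) \<longleftrightarrow> (\<forall>i<length us. us ! i \<bullet> v = 0)"
      using assms by (auto simp: vec_eq_iff nth_mem subset_iff)
    also have "\<dots> \<longleftrightarrow> (\<forall>y\<in>set us. y \<bullet> v = 0)"
      by (auto simp: all_set_conv_all_nth)
    also have "\<dots> \<longleftrightarrow> (\<forall>y\<in>set us. v \<bullet> y = 0)"
      using assms v by (intro ball_cong refl) (auto simp: comm_scalar_prod[of _ n])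
    finally show ?thesis .
  qed
  then show ?thesis
    by (auto simp: mat_kernel_def orthogonal_complement_def)
qed

text \<open>
  A basis of the span, written as the rows of a matrix, stays a generating set under Gauss--Jordan
  elimination, so the echelon form has no zero row and its kernel has the complementary dimension.
\<close>

lemma dim_span_orthogonal_complement:
  assumes S: "finite S" "S \<subseteq> carrier_vec n"
  shows "vectorspace.dim class_ring (span_vs S)
    + vectorspace.dim class_ring (vs (orthogonal_complement S)) = n"
proof -
  obtain U where U: "finite U" "U \<subseteq> carrier_vec n" "lin_indpt U" "span U = span S"
    using span_basis_exists[OF S] .
  obtain us where us: "set us = U" "distinct us" using finite_distinct_list[OF U(1)] by auto
  define d where "d = length us"
  have card_U: "card U = d" using us distinct_card d_def by metis
  have d: "d = vectorspace.dim class_ring (span_vs S)"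
    using dim_span_lin_indpt[OF U(1-3)] U(4) card_U by simp
  have dn: "d \<le> n"
    using li_le_dim(2)[OF fin_dim _ U(3)] U(2) card_U dim_is_n by simp
  define M where "M = mat_of_rows n us"
  have M: "M \<in> carrier_mat d n" by (simp add: M_def d_def mat_of_rows_def)
  have rows_M: "rows M = us" unfolding M_def using us U(2) by simp
  have ker_M: "mat_kernel M = orthogonal_complement S"
    unfolding M_def using mat_kernel_mat_of_rows[of us] us U(2,4)
      in_orthogonal_complement_span[OF U(2)] in_orthogonal_complement_span[OF S(2)] by simp
  define C where "C = gauss_jordan_single M"
  obtain P Q where CPM: "C = P * M" and QP: "Q * P = 1\<^sub>m d" and P: "P \<in> carrier_mat d d"
    and Q: "Q \<in> carrier_mat d d" and C: "C \<in> carrier_mat d n" and ref: "row_echelon_form C"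
    using gauss_jordan_single[OF M C_def[symmetric]] by auto
  have PQ: "P * Q = 1\<^sub>m d" by (rule mat_mult_left_right_inverse[OF Q P QP])
  \<comment> \<open>Left multiplication by an invertible matrix keeps the row space, used here, and
    the kernel, used at the end.\<close>
  have "invertible_mat P"
    unfolding invertible_mat_def inverts_mat_def using P Q QP PQ by auto
  then have "row_space C = row_space M"
    unfolding CPM using P M by (rule row_space_is_preserved)
  then have span_C: "span (set (rows C)) = span S"
    unfolding row_space_def rows_M us(1) U(4) .
  define I where "I = {i. i < d \<and> row C i \<noteq> 0\<^sub>v n}"
  have fin_I: "finite I" by (simp add: I_def)
  have RC: "row C ` I \<subseteq> carrier_vec n" using C by (auto simp: I_def)
  have "set (rows C) \<subseteq> span (row C ` I)"
  proof
    fix v assume "v \<in> set (rows C)"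
    then obtain i where i: "i < d" "v = row C i" using C by (auto simp: rows_def)
    show "v \<in> span (row C ` I)"
    proof (cases "v = 0\<^sub>v n")
      case True
      then show ?thesis using span_is_monotone[of "{}" "row C ` I"] span_empty by auto
    next
      case False
      then have "v \<in> row C ` I" using i by (auto simp: I_def)
      then show ?thesis using in_own_span[of "row C ` I"] RC by auto
    qed
  qed
  then have "span (set (rows C)) \<subseteq> span (row C ` I)"
    using span_is_subset[OF _ span_is_submodule] RC by simp
  moreover have "span (row C ` I) \<subseteq> span (set (rows C))"
    by (rule span_is_monotone) (use C in \<open>auto simp: I_def rows_def\<close>)
  ultimately have span_I: "span (row C ` I) = span S" using span_C by simp
  have vs: "vectorspace class_ring (span_vs S)"
    using S span_is_subspace subspace_def subspace_is_vs by simp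
  have sub_I: "row C ` I \<subseteq> span S"
    using in_own_span[of "row C ` I"] RC span_I by auto
  \<comment> \<open>The nonzero rows generate a space of dimension \<open>d\<close>, so there are at
    least \<open>d\<close> of them, and \<open>C\<close> has only \<open>d\<close> rows.\<close>
  have "vectorspace.dim class_ring (span_vs S) \<le> card (row C ` I)"
  proof (rule vectorspace.gen_ge_dim[OF vs])
    show "LinearCombinations.module.span class_ring (span_vs S) (row C ` I) = carrier (span_vs S)"
      using span_li_not_depend(1)[OF sub_I span_is_submodule] S span_I by simp
  qed (use sub_I fin_I in auto)
  also have "\<dots> \<le> card I" using fin_I by (rule card_image_le)
  finally have "d \<le> card I" unfolding d .
  moreover have "card I \<le> d" using card_mono[of "{..<d}" I] by (auto simp: I_def)
  ultimately have "card I = d" by simp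
  then have "kernel.dim n C = n - d"
    using find_base_vectors(6)[OF ref C] by (simp add: I_def)
  moreover have "mat_kernel C = orthogonal_complement S"
    unfolding CPM ker_M[symmetric] by (rule mat_kernel_mult_eq[OF M P Q QP])
  ultimately show ?thesis using dn d by simp
qed

end

section \<open>Spans of one and of two vectors\<close>

lemma smult_vec_eq_0D:
  fixes v :: "'a::idom vec"
  assumes "l \<cdot>\<^sub>v v = 0\<^sub>v n" "v \<in> carrier_vec n" "v \<noteq> 0\<^sub>v n"
  shows "l = 0"
proof -
  obtain i where "i < n" "v $ i \<noteq> 0" using assms(2,3) by (auto simp: vec_eq_iff)
  moreover have "(l \<cdot>\<^sub>v v) $ i = 0" using assms \<open>i < n\<close> by simp
  ultimately show ?thesis using assms(2) by simp
qed

context vec_space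
begin

lemma lin_indpt_singleton:
  assumes "v \<in> carrier_vec n" "v \<noteq> 0\<^sub>v n"
  shows "lin_indpt {v}"
  by (rule finite_lin_indpt2) (use assms in \<open>auto simp: lincomb_def dest: smult_vec_eq_0D\<close>)

lemma span_singleton:
  assumes "v \<in> carrier_vec n"
  shows "span {v} = {l \<cdot>\<^sub>v v | l. True}"
proof -
  have "span {v} = {lincomb f {v} | f. f \<in> {v} \<rightarrow> UNIV}"
    using finite_span[of "{v}"] assms by simp
  also have "\<dots> = {f v \<cdot>\<^sub>v v | f. True}"
    using assms by (simp add: lincomb_def)
  also have "\<dots> = {l \<cdot>\<^sub>v v | l. True}"
  proof safe
    fix l show "\<exists>f. l \<cdot>\<^sub>v v = f v \<cdot>\<^sub>v v \<and> True" by (rule exI[of _ "\<lambda>_. l"]) simp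
  qed blast
  finally show ?thesis .
qed

lemma span_pair:
  assumes "v \<in> carrier_vec n" "w \<in> carrier_vec n" "v \<noteq> w"
  shows "span {v, w} = {l \<cdot>\<^sub>v v + m \<cdot>\<^sub>v w | l m. True}"
proof -
  have "span {v, w} = {lincomb f {v, w} | f. f \<in> {v, w} \<rightarrow> UNIV}"
    using finite_span[of "{v, w}"] assms by simp
  also have "\<dots> = {f v \<cdot>\<^sub>v v + f w \<cdot>\<^sub>v w | f. True}"
    using assms by (simp add: lincomb_def)
  also have "\<dots> = {l \<cdot>\<^sub>v v + m \<cdot>\<^sub>v w | l m. True}"
  proof safe
    fix l m show "\<exists>f. l \<cdot>\<^sub>v v + m \<cdot>\<^sub>v w = f v \<cdot>\<^sub>v v + f w \<cdot>\<^sub>v w \<and> True"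
      using assms(3) by (intro exI[of _ "\<lambda>u. if u = v then l else m"]) simp
  qed blast
  finally show ?thesis .
qed

lemma dim_span_singleton:
  assumes "v \<in> carrier_vec n" "v \<noteq> 0\<^sub>v n"
  shows "vectorspace.dim class_ring (span_vs {v}) = 1"
  using dim_span_lin_indpt[of "{v}"] lin_indpt_singleton assms by simp

lemma dim_span_pair:
  assumes "v \<in> carrier_vec n" "w \<in> carrier_vec n" "w \<noteq> 0\<^sub>v n" "\<And>l. v \<noteq> l \<cdot>\<^sub>v w"
  shows "vectorspace.dim class_ring (span_vs {v, w}) = 2"
proof -
  have vw: "v \<noteq> w" using assms(4)[of 1] by auto
  have "v \<notin> span {w}" using span_singleton[OF assms(2)] assms(4) by auto
  then have "lin_indpt ({w} \<union> {v})"
    using lin_dep_iff_in_span[of "{w}" v] lin_indpt_singleton[OF assms(2,3)] assms vw by auto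
  then have "lin_indpt {v, w}" by (simp add: insert_commute)
  then show ?thesis using dim_span_lin_indpt[of "{v, w}"] assms vw by simp
qed

end

section \<open>The dimension of a sequence\<close>

lemma finite_zero_sum_vecs: "finite (zero_sum_vecs A)"
proof (rule finite_subset)
  have "x = vec (length A) (\<lambda>i. if i \<in> {i. i < length A \<and> x $ i = 1} then 1 else 0)"
    if "x \<in> zero_sum_vecs A" for x
    using that by (auto simp: zero_sum_vecs_def vec_eq_iff)
  then show "zero_sum_vecs A
      \<subseteq> (\<lambda>I. vec (length A) (\<lambda>i. if i \<in> I then 1 else 0)) ` Pow {..<length A}"
    by blast
qed simp

lemma zero_sum_vecs_carrier: "zero_sum_vecs A \<subseteq> carrier_vec (length A)"
  by (auto simp: zero_sum_vecs_def)

lemma scalar_prod_indicator: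
  assumes "I \<subseteq> {..<n}"
  shows "b \<bullet> vec n (\<lambda>i. if i \<in> I then 1 else 0) = (\<Sum>i\<in>I. b $ i :: 'a::semiring_1)"
proof -
  have "b \<bullet> vec n (\<lambda>i. if i \<in> I then 1 else 0) = (\<Sum>i = 0..<n. if i \<in> I then b $ i else 0)"
    unfolding scalar_prod_def by (intro sum.cong) auto
  also have "\<dots> = (\<Sum>i\<in>{0..<n} \<inter> I. b $ i)"
    by (simp add: sum.inter_restrict)
  also have "{0..<n} \<inter> I = I" using assms by auto
  finally show ?thesis .
qed

text \<open>Zero-sum 0-1 vectors are the indicators of zero-sum index sets, and the product with an
  indicator is a subset sum. This is the form that \<open>zero_sum_relation\<close> expects.\<close>

lemma orthogonal_complement_zero_sum_vecs_iff:
  "b \<in> vec_module.orthogonal_complement (length A) (zero_sum_vecs A) \<longleftrightarrow>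
    b \<in> carrier_vec (length A) \<and>
    (\<forall>I\<subseteq>{..<length A}. (\<Sum>i\<in>I. A ! i) = 0 \<longrightarrow> (\<Sum>i\<in>I. b $ i) = 0)"
proof -
  let ?v = "\<lambda>I. vec (length A) (\<lambda>i. if i \<in> I then 1 else 0)"
  have sum_v: "(\<Sum>i<length A. A ! i * ?v I $ i) = (\<Sum>i\<in>I. A ! i)" if I: "I \<subseteq> {..<length A}" for I
  proof -
    have "(\<Sum>i<length A. A ! i * ?v I $ i) = (\<Sum>i\<in>I. A ! i * ?v I $ i)"
      by (rule sum.mono_neutral_right) (use I in auto)
    also have "\<dots> = (\<Sum>i\<in>I. A ! i)" using I by (intro sum.cong) auto
    finally show ?thesis .
  qed
  have "zero_sum_vecs A = ?v ` {I. I \<subseteq> {..<length A} \<and> (\<Sum>i\<in>I. A ! i) = 0}"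
  proof
    show "zero_sum_vecs A \<subseteq> ?v ` {I. I \<subseteq> {..<length A} \<and> (\<Sum>i\<in>I. A ! i) = 0}"
    proof
      fix x assume x: "x \<in> zero_sum_vecs A"
      define I where "I = {i. i < length A \<and> x $ i = 1}"
      have "x = ?v I" using x by (auto simp: zero_sum_vecs_def vec_eq_iff I_def)
      moreover have "I \<subseteq> {..<length A}" by (auto simp: I_def)
      ultimately show "x \<in> ?v ` {I. I \<subseteq> {..<length A} \<and> (\<Sum>i\<in>I. A ! i) = 0}"
        using x sum_v[of I] by (auto simp: zero_sum_vecs_def)
    qed
    show "?v ` {I. I \<subseteq> {..<length A} \<and> (\<Sum>i\<in>I. A ! i) = 0} \<subseteq> zero_sum_vecs A"
      using sum_v by (auto simp: zero_sum_vecs_def)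
  qed
  then show ?thesis
    unfolding vec_module.orthogonal_complement_def by (auto simp: scalar_prod_indicator)
qed

lemma seq_dim_add_dim_orthogonal_complement:
  fixes A :: "'p::prime_card mod_ring list"
  shows "seq_dim A + vectorspace.dim class_ring (module_vec TYPE('p mod_ring) (length A)
    \<lparr>carrier := vec_module.orthogonal_complement (length A) (zero_sum_vecs A)\<rparr>) = length A"
  unfolding seq_dim_def Let_def
  by (rule vec_space.dim_span_orthogonal_complement[OF finite_zero_sum_vecs zero_sum_vecs_carrier])

text \<open>A set of m indices has sum \<open>m * r\<close>, so only the empty and the full set have
  sum zero, and the span is the line of the all-ones vector.\<close>

lemma seq_dim_replicate:
  fixes r :: "'p::prime_card mod_ring"
  assumes "r \<noteq> 0"
  shows "seq_dim (replicate (CARD('p)) r) = 1"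
proof -
  interpret V: vec_space "TYPE('p mod_ring)" "CARD('p)" .
  define u :: "'p mod_ring vec" where "u = vec CARD('p) (\<lambda>_. 1)"
  have u: "u \<in> carrier_vec CARD('p)" "u \<noteq> 0\<^sub>v CARD('p)"
    by (auto simp: u_def vec_eq_iff intro!: exI[of _ 0])
  have sub: "zero_sum_vecs (replicate (CARD('p)) r) \<subseteq> {0\<^sub>v CARD('p), u}"
  proof
    fix x assume x: "x \<in> zero_sum_vecs (replicate (CARD('p)) r)"
    define I where "I = {i. i < CARD('p) \<and> x $ i = 1}"
    have "(\<Sum>i<CARD('p). r * x $ i) = (\<Sum>i\<in>I. r * x $ i)"
      by (rule sum.mono_neutral_right) (use x in \<open>auto simp: I_def zero_sum_vecs_def\<close>)
    also have "\<dots> = of_nat (card I) * r" by (simp add: I_def)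
    finally have "of_nat (card I) * r = 0"
      using x by (simp add: zero_sum_vecs_def)
    then have "CARD('p) dvd card I" using assms by (intro of_nat_0_mod_ring_dvd) simp
    moreover have "card I \<le> CARD('p)" "finite I"
      using card_mono[of "{..<CARD('p)}" I] by (auto simp: I_def)
    ultimately have "I = {} \<or> card I = card {..<CARD('p)}"
      using dvd_imp_le[of "CARD('p)" "card I"] by (cases "card I = 0") auto
    then have "I = {} \<or> I = {..<CARD('p)}"
      using card_subset_eq[of "{..<CARD('p)}" I] by (auto simp: I_def)
    then show "x \<in> {0\<^sub>v CARD('p), u}"
      using x by (auto simp: zero_sum_vecs_def I_def u_def vec_eq_iff)
  qed
  have "(\<Sum>i<CARD('p). r * u $ i) = of_nat CARD('p) * r"
    by (simp add: u_def)
  then have "u \<in> zero_sum_vecs (replicate (CARD('p)) r)"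
    by (auto simp: zero_sum_vecs_def u_def)
  then have "V.span {u} \<subseteq> V.span (zero_sum_vecs (replicate (CARD('p)) r))"
    by (intro V.span_is_monotone) simp
  moreover have "V.span (zero_sum_vecs (replicate (CARD('p)) r)) \<subseteq> V.span {u}"
  proof (rule V.span_is_subset)
    have "0\<^sub>v CARD('p) \<in> V.span {u}"
      using V.span_is_monotone[of "{}" "{u}"] V.span_empty by auto
    then show "zero_sum_vecs (replicate (CARD('p)) r) \<subseteq> V.span {u}"
      using sub V.in_own_span[of "{u}"] u(1) by auto
    show "submodule class_ring (V.span {u}) V.V"
      by (rule V.span_is_submodule) (use u(1) in simp)
  qed
  ultimately have "V.span (zero_sum_vecs (replicate (CARD('p)) r)) = V.span {u}" by simp
  then show ?thesis
    using V.dim_span_singleton[OF u] by (simp add: seq_dim_def Let_def)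
qed

lemma mset_nth: "mset xs = image_mset (\<lambda>i. xs ! i) (mset_set {..<length xs})"
proof -
  have "mset xs = mset (map (\<lambda>i. xs ! i) [0..<length xs])" by (simp add: map_nth)
  then show ?thesis by (simp add: atLeast0LessThan)
qed

section \<open>The three cases, read off from the orthogonal complement\<close>

theorem theorem1p4:
  fixes A :: "'p :: prime_card mod_ring list" and p :: nat
  assumes "p = CARD('p)"
    and "length A = p"
    and "\<forall>a \<in> set A. a \<noteq> 0"
  shows "(seq_dim A = 1 \<and> (\<exists>r. r \<noteq> 0 \<and> A = replicate p r))
    \<or> (seq_dim A = p - 2 \<and>
        (\<exists>t \<sigma> r. 1 \<le> t \<and> t + 3 \<le> p \<and> \<sigma> permutes {..<p} \<and> r \<noteq> 0 \<and>
          permute_list \<sigma> A =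
            replicate t r @ replicate (p - 2 - t) (- r) @
            [- ((of_nat t + 1) * r), - ((of_nat t + 1) * r)]))
    \<or> seq_dim A = p - 1"
proof -
  interpret V: vec_space "TYPE('p mod_ring)" p .
  have p: "CARD('p) = p" and len: "length A = p" using assms by simp_all
  have p2: "2 \<le> p" using prime_ge_2_nat[OF prime_card[where 'a='p]] p by simp
  define a where "a k = A ! k" for k
  define K where "K = V.orthogonal_complement (zero_sum_vecs A)"
  define av where "av = vec p a"
  have nz: "a k \<noteq> 0" if "k < p" for k using that assms(3) len by (simp add: a_def)
  have K_iff: "b \<in> K \<longleftrightarrow> b \<in> carrier_vec p \<and>
      (\<forall>I\<subseteq>{..<p}. sum a I = 0 \<longrightarrow> (\<Sum>i\<in>I. b $ i) = 0)" for b
    using orthogonal_complement_zero_sum_vecs_iff[of b A] unfolding len K_def a_def .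
  have dim: "seq_dim A + vectorspace.dim class_ring (V.vs K) = p"
    using seq_dim_add_dim_orthogonal_complement[of A] unfolding len K_def .
  have av: "av \<in> carrier_vec p" "av \<noteq> 0\<^sub>v p"
    using nz[of 0] p2 by (auto simp: av_def vec_eq_iff intro!: exI[of _ 0])
  have sum_vec: "(\<Sum>i\<in>I. (l \<cdot>\<^sub>v av) $ i) = l * sum a I" if "I \<subseteq> {..<p}" for l I
    unfolding sum_distrib_left by (intro sum.cong) (use that in \<open>auto simp: av_def\<close>)
  have rel: "zero_sum_relation {..<p} a (\<lambda>k. b $ k / a k)" if "b \<in> K" for b
  proof
    fix I assume I: "I \<subseteq> {..<p}" "sum a I = 0"
    have "(\<Sum>k\<in>I. a k * (b $ k / a k)) = (\<Sum>k\<in>I. b $ k)"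
      by (intro sum.cong) (use I nz in auto)
    then show "(\<Sum>k\<in>I. a k * (b $ k / a k)) = 0" using that I K_iff by simp
  qed (use p nz in auto)
  \<comment> \<open>\<open>K\<close> contains every multiple of \<open>av\<close>; for nonconstant
    \<open>a\<close> the cases ask whether it contains more.\<close>
  consider (const) "\<exists>r. \<forall>k<p. a k = r"
    | (line) "\<forall>b\<in>K. \<exists>l. b = l \<cdot>\<^sub>v av"
    | (exceptional) b where "\<nexists>r. \<forall>k<p. a k = r" "b \<in> K" "\<And>l. b \<noteq> l \<cdot>\<^sub>v av"
    by blast
  then show ?thesis
  proof cases
    case const
    then obtain r where "\<forall>k<p. a k = r" by blast
    then have "A = replicate p r" "r \<noteq> 0"
      using nz[of 0] p2 len by (auto simp: a_def list_eq_iff_nth_eq)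
    then show ?thesis using seq_dim_replicate[of r] p by auto
  next
    case line
    have "K = V.span {av}"
      unfolding V.span_singleton[OF av(1)]
      using line sum_vec av(1) by (auto simp: K_iff)
    then have "seq_dim A = p - 1" using V.dim_span_singleton[OF av] dim by simp
    then show ?thesis by blast
  next
    case exceptional
    interpret R: zero_sum_relation "{..<p}" a "\<lambda>k. b $ k / a k" by (rule rel) fact
    have nonconst: "\<nexists>r. \<forall>k\<in>{..<p}. a k = r" using exceptional(1) by (simp only: Ball_def lessThan_iff not_False_eq_True)
    have "\<nexists>l. \<forall>k\<in>{..<p}. b $ k / a k = l"
    proof
      assume "\<exists>l. \<forall>k\<in>{..<p}. b $ k / a k = l"
      then obtain l where "\<forall>k<p. b $ k / a k = l" by auto
      then have "b = l \<cdot>\<^sub>v av"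
        using nz exceptional(2) by (auto simp: K_iff vec_eq_iff av_def field_simps)
      then show False using exceptional(3) by simp
    qed
    note exc = R.nonconstant_imp_exceptional_pair[OF nonconst this]
    note p3 = exc(1) and s = exc(2)
    obtain i j l where ij: "R.exceptional_pair i j" and l: "b $ i / a i \<noteq> l"
        "b $ i / a i + b $ j / a j = 2 * l" "\<forall>k\<in>{..<p} - {i, j}. b $ k / a k = l"
      using exc(3) by blast
    have ij': "i < p" "j < p" "i \<noteq> j" "a j = a i"
      using ij by (auto simp: R.exceptional_pair_def)
    \<comment> \<open>The quotients \<open>b $ k / a k\<close> deviate from \<open>l\<close> only on
      the pair, by opposite amounts, and \<open>a i = a j\<close>; so \<open>b\<close> differs from
      \<open>l\<close> times \<open>av\<close> by a multiple of this vector.\<close>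
    define w :: "'p mod_ring vec" where "w = unit_vec p i - unit_vec p j"
    have w: "w \<in> carrier_vec p" by (simp add: w_def)
    have w_nth: "w $ k = (if k = i then 1 else if k = j then - 1 else 0)" if "k < p" for k
      using that ij' by (auto simp: w_def)
    \<comment> \<open>Kept general in \<open>b\<close> and \<open>l\<close>: it serves the given
      \<open>b\<close> and later every element of \<open>K\<close>.\<close>
    have decomp: "b = l \<cdot>\<^sub>v av + ((b $ i / a i - l) * a i) \<cdot>\<^sub>v w"
      if b: "b \<in> carrier_vec p" and l: "b $ i / a i + b $ j / a j = 2 * l"
        "\<forall>k\<in>{..<p} - {i, j}. b $ k / a k = l" for b l
    proof (rule eq_vecI)
      fix k assume "k < dim_vec (l \<cdot>\<^sub>v av + ((b $ i / a i - l) * a i) \<cdot>\<^sub>v w)"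
      then have k: "k < p" by (simp add: w_def)
      consider "k = i" | "k = j" | "k \<in> {..<p} - {i, j}" using k by auto
      then show "b $ k = (l \<cdot>\<^sub>v av + ((b $ i / a i - l) * a i) \<cdot>\<^sub>v w) $ k"
      proof cases
        case 1
        then show ?thesis using k w nz[of i] by (simp add: av_def w_nth algebra_simps)
      next
        case 2
        have "b $ i + b $ j = 2 * l * a i"
          using l(1) nz[of i] ij' by (simp add: add_divide_distrib[symmetric] divide_eq_eq)
        then show ?thesis using 2 k w nz[of i] ij' by (simp add: av_def w_nth algebra_simps)
      next
        case 3
        then have "b $ k = l * a k" using l(2) nz[OF k] by (auto simp: divide_eq_eq)
        then show ?thesis using 3 k w by (simp add: av_def w_nth)
      qed
    qed (use b w in simp)
    \<comment> \<open>Up to the nonzero factor \<open>d\<close>, \<open>w\<close> is what remains of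
      \<open>b\<close> after subtracting \<open>l\<close> times \<open>av\<close>.\<close>
    have w_K: "(\<Sum>k\<in>I. w $ k) = 0" if I: "I \<subseteq> {..<p}" "sum a I = 0" for I
    proof -
      define d where "d = (b $ i / a i - l) * a i"
      have d: "d \<noteq> 0" using l(1) nz[OF ij'(1)] by (simp add: d_def)
      have b: "b \<in> carrier_vec p" using exceptional(2) K_iff by simp
      have "(\<Sum>k\<in>I. b $ k) = (\<Sum>k\<in>I. (l \<cdot>\<^sub>v av) $ k + d * w $ k)"
        by (subst decomp[OF b l(2,3)], intro sum.cong refl) (use I w in \<open>auto simp: d_def\<close>)
      also have "\<dots> = d * (\<Sum>k\<in>I. w $ k)"
        using sum_vec[OF I(1), of l] I(2) by (simp add: sum.distrib sum_distrib_left)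
      finally show ?thesis using exceptional(2) I d by (simp add: K_iff)
    qed
    \<comment> \<open>At a third index \<open>w\<close> vanishes while \<open>av\<close> does
      not.\<close>
    obtain k where k: "k < p" "k \<noteq> i" "k \<noteq> j"
    proof -
      have "\<not> {..<p} \<subseteq> {i, j}"
        using card_mono[of "{i, j}" "{..<p}"] ij'(3) p3 p by auto
      then show ?thesis using that by auto
    qed
    have av_w: "av \<noteq> m \<cdot>\<^sub>v w" for m
    proof
      assume "av = m \<cdot>\<^sub>v w"
      then have "av $ k = (m \<cdot>\<^sub>v w) $ k" by simp
      then show False using k w nz[of k] by (simp add: av_def w_nth)
    qed
    have w0: "w \<noteq> 0\<^sub>v p"
      using w_nth[OF ij'(1)] ij'(1) by auto
    have "K = V.span {av, w}"
    proof
      show "K \<subseteq> V.span {av, w}"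
      proof
        fix b' assume b': "b' \<in> K"
        \<comment> \<open>The pair was found through \<open>b\<close>, but being exceptional depends
          on \<open>a\<close> only and so carries over to \<open>b'\<close>.\<close>
        interpret R': zero_sum_relation "{..<p}" a "\<lambda>k. b' $ k / a k" by (rule rel) fact
        obtain l' where "\<forall>k\<in>{..<p} - {i, j}. b' $ k / a k = l'" "b' $ i / a i + b' $ j / a j = 2 * l'"
          using R'.exceptional_pair_relation[OF p3 s ij] by blast
        then have "b' = l' \<cdot>\<^sub>v av + ((b' $ i / a i - l') * a i) \<cdot>\<^sub>v w"
          using decomp b' K_iff by blast
        then show "b' \<in> V.span {av, w}"
          unfolding V.span_pair[OF av(1) w av_w[of 1, simplified]] by blast
      qed
      show "V.span {av, w} \<subseteq> K"
      proof
        fix x assume "x \<in> V.span {av, w}"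
        then obtain l m where x: "x = l \<cdot>\<^sub>v av + m \<cdot>\<^sub>v w"
          unfolding V.span_pair[OF av(1) w av_w[of 1, simplified]] by blast
        have "(\<Sum>k\<in>I. x $ k) = 0" if I: "I \<subseteq> {..<p}" "sum a I = 0" for I
        proof -
          have "(\<Sum>k\<in>I. x $ k) = (\<Sum>k\<in>I. (l \<cdot>\<^sub>v av) $ k + m * w $ k)"
            unfolding x by (intro sum.cong refl) (use I w in auto)
          also have "\<dots> = 0"
            using sum_vec[OF I(1), of l] w_K[OF I] I(2) by (simp add: sum.distrib flip: sum_distrib_left)
          finally show ?thesis .
        qed
        then show "x \<in> K" using x av(1) w by (simp add: K_iff)
      qed
    qed
    then have dim_A: "seq_dim A = p - 2"
      using V.dim_span_pair[OF av(1) w w0 av_w] dim by simp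
    obtain T r where T: "T \<subseteq> {..<p} - {i, j}" "T \<noteq> {}" "T \<noteq> {..<p} - {i, j}" "r \<noteq> 0"
      and aT: "\<forall>k\<in>T. a k = r" "\<forall>k\<in>{..<p} - {i, j} - T. a k = - r"
        "a i = - ((of_nat (card T) + 1) * r)"
      by (rule R.exceptional_pair_values[OF p3 s ij])
    define t where "t = card T"
    define U where "U = {..<p} - {i, j} - T"
    have fin: "finite T" "finite U" using T(1) finite_subset by (auto simp: U_def)
    have card_Y: "card ({..<p} - {i, j}) = p - 2" using ij' by (simp add: card_Diff_subset)
    \<comment> \<open>\<open>T\<close> is a nonempty proper subset of \<open>p - 2\<close> indices;
      the strict bound later becomes \<open>t + 3 \<le> p\<close>.\<close>
    have t: "1 \<le> t" "t < p - 2"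
      using T fin psubset_card_mono[of "{..<p} - {i, j}" T] card_Y
      by (auto simp: t_def Suc_le_eq card_gt_0_iff)
    have card_U: "card U = p - 2 - t"
      unfolding U_def t_def using T fin card_Y by (simp add: card_Diff_subset)
    have X: "{..<p} = T \<union> U \<union> {i, j}" "T \<inter> U = {}" "(T \<union> U) \<inter> {i, j} = {}"
      using T ij' by (auto simp: U_def)
    let ?v = "- ((of_nat t + 1) * r)"
    \<comment> \<open>The permutation comes from an equality of multisets, obtained by splitting the
      indices into \<open>T\<close>, \<open>U\<close> and the pair.\<close>
    have "mset A = image_mset a (mset_set {..<p})"
      using mset_nth[of A] unfolding len a_def .
    also have "\<dots> = image_mset a (mset_set T) + image_mset a (mset_set U) + {#a i, a j#}"
      unfolding X(1) using fin X ij' by (simp add: mset_set_Union)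
    also have "image_mset a (mset_set T) = image_mset (\<lambda>_. r) (mset_set T)"
      using aT fin by (intro image_mset_cong) auto
    also have "image_mset a (mset_set U) = image_mset (\<lambda>_. - r) (mset_set U)"
      using aT fin by (intro image_mset_cong) (auto simp: U_def)
    finally have "mset (replicate t r @ replicate (p - 2 - t) (- r) @ [?v, ?v]) = mset A"
      using aT(3) ij'(4) card_U by (simp add: image_mset_const_eq t_def)
    then obtain \<sigma> where \<sigma>: "\<sigma> permutes {..<p}"
        "permute_list \<sigma> A = replicate t r @ replicate (p - 2 - t) (- r) @ [?v, ?v]"
      using mset_eq_permutation[of "replicate t r @ replicate (p - 2 - t) (- r) @ [?v, ?v]" A] len by blast
    have "t + 3 \<le> p" using t by linarith
    then show ?thesis using dim_A t(1) T(4) \<sigma> by blast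
  qed
qed

end
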